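(* Let $M_1, M_2$ be smooth manifolds, $A_i=C^\infty(M_i)$ for $i=1,2$, let $C$ be a commutative associative unital $\mathbb{R}$-algebra, and let $p_i\colon A_i\to C$ be surjective unital $\mathbb{R}$-algebra homomorphisms. Let $A=\{(a_1,a_2)\in A_1\oplus A_2 : p_1(a_1)=p_2(a_2)\}$ with projections $\pi_i\colon A\to A_i$. Assume that for $i=1,2$ the closure in $|A|$ of the interior of $|\pi_i|(|A_i|)$ equals $|\pi_i|(|A_i|)$. Then for every $k\ge 0$ $$\mathrm{Diff}_{k}(A)=\{(\Delta_1, \Delta_2) \mid \Delta_i\in\mathrm{Diff}_{k}(A_i)\ (i=1,2),\ p_1\circ\Delta_1\circ\pi_1 = p_2\circ\Delta_2\circ\pi_2 \},$$ where $\Delta\in\mathrm{Diff}_k(A)$ is identified with the pair $(\Delta_1,\Delta_2)$ of linear maps $\Delta_i\colon A_i\to A_i$ uniquely determined by $\pi_i\circ\Delta=\Delta_i\circ\pi_i$; that is, $\Delta\mapsto(\Delta_1,\Delta_2)$ is a well-defined bijection from $\mathrm{Diff}_k(A)$ onto the set on the right-hand side.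
   Context: For a commutative associative unital $\mathbb{R}$-algebra $B$, $|B|=\mathrm{Spec}_{\mathbb{R}}B$ is the set of unital $\mathbb{R}$-algebra homomorphisms $h\colon B\to\mathbb{R}$ with the Zariski topology generated by the sets $U_b=\{h\in|B|: h(b)\ne0\}$, $b\in B$. A unital homomorphism $\varphi\colon B\to B'$ induces $|\varphi|\colon|B'|\to|B|$, $h\mapsto h\circ\varphi$. For $b\in B$ and an $\mathbb{R}$-linear map $\Delta\colon B\to B$ put $\delta_b(\Delta)=\Delta\circ b-b\circ\Delta$, where $b$ also denotes multiplication by $b$. $\Delta$ is a linear differential operator of order $\le k$ if $(\delta_{b_0}\circ\dots\circ\delta_{b_k})(\Delta)=0$ for all $b_0,\dots,b_k\in B$; $\mathrm{Diff}_k(B)$ is the set of all such operators $B\to B$. *)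

theory Defs
  imports "HOL-Analysis.Analysis" "HOL-Algebra.Module"
begin

section \<open>Smooth manifolds\<close>

definition partial_deriv :: "nat \<Rightarrow> ((nat \<Rightarrow> real) \<Rightarrow> real) \<Rightarrow> (nat \<Rightarrow> real) \<Rightarrow> real" where
  "partial_deriv i f x = deriv (\<lambda>t. f (x(i := t))) (x i)"

text \<open>\<open>Ck_on k n S f\<close>, for \<open>S\<close> open in \<^const>\<open>Euclidean_space\<close> \<open>n\<close>: all iterated partial derivatives
  of \<open>f\<close> of order \<open>\<le> k\<close> exist and are continuous on \<open>S\<close>. Only the values of \<open>f\<close> on \<open>S\<close> matter.
  The carrier \<^const>\<open>Euclidean_space\<close> \<open>n\<close> is the space of sequences vanishing from index \<open>n\<close> on,
  so that dimension \<open>0\<close> is covered as well.\<close>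

primrec Ck_on :: "nat \<Rightarrow> nat \<Rightarrow> (nat \<Rightarrow> real) set \<Rightarrow> ((nat \<Rightarrow> real) \<Rightarrow> real) \<Rightarrow> bool" where
  "Ck_on 0 n S f \<longleftrightarrow> continuous_map (subtopology (Euclidean_space n) S) euclideanreal f"
| "Ck_on (Suc k) n S f \<longleftrightarrow>
     continuous_map (subtopology (Euclidean_space n) S) euclideanreal f \<and>
     (\<forall>i<n. (\<forall>x\<in>S. (\<lambda>t. f (x(i := t))) field_differentiable (at (x i))) \<and>
            Ck_on k n S (partial_deriv i f))"

definition smooth_on :: "nat \<Rightarrow> (nat \<Rightarrow> real) set \<Rightarrow> ((nat \<Rightarrow> real) \<Rightarrow> real) \<Rightarrow> bool" where
  "smooth_on n S f \<longleftrightarrow> (\<forall>k. Ck_on k n S f)"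

type_synonym 'm chart = "'m set \<times> ('m \<Rightarrow> nat \<Rightarrow> real)"

definition is_chart :: "nat \<Rightarrow> 'm topology \<Rightarrow> 'm chart \<Rightarrow> bool" where
  "is_chart n M = (\<lambda>(U, \<phi>).
     openin M U \<and> openin (Euclidean_space n) (\<phi> ` U) \<and>
     homeomorphic_map (subtopology M U) (subtopology (Euclidean_space n) (\<phi> ` U)) \<phi>)"

text \<open>The atlas need not be maximal: the smooth functions defined below are the same for an atlas
  and for the maximal atlas containing it.\<close>

definition smooth_atlas :: "nat \<Rightarrow> 'm topology \<Rightarrow> 'm chart set \<Rightarrow> bool" where
  "smooth_atlas n M \<A> \<longleftrightarrow>
     (\<forall>c\<in>\<A>. is_chart n M c) \<and>
     (\<Union>(U, \<phi>)\<in>\<A>. U) = topspace M \<and>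
     (\<forall>(U, \<phi>)\<in>\<A>. \<forall>(V, \<psi>)\<in>\<A>. \<forall>i<n.
        smooth_on n (\<phi> ` (U \<inter> V)) (\<lambda>x. \<psi> (inv_into U \<phi> x) i))"

definition smooth_manifold :: "nat \<Rightarrow> 'm topology \<Rightarrow> 'm chart set \<Rightarrow> bool" where
  "smooth_manifold n M \<A> \<longleftrightarrow>
     Hausdorff_space M \<and> second_countable M \<and> smooth_atlas n M \<A>"


section \<open>Commutative algebras over the reals\<close>

text \<open>The reals as an algebra over themselves. This record also serves as the base ring, so a
  commutative associative unital real algebra \<open>B\<close> is given by \<open>Module.algebra real_alg B\<close>; the zero
  algebra is included.\<close>

definition real_alg :: "(real, real) module" where
  "real_alg = \<lparr>carrier = UNIV, mult = (*), one = 1, zero = 0, add = (+), smult = (*)\<rparr>"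

definition alg_hom :: "(real, 'b) module \<Rightarrow> (real, 'c) module \<Rightarrow> ('b \<Rightarrow> 'c) set" where
  "alg_hom B C = {h \<in> ring_hom B C.
     \<forall>r. \<forall>x\<in>carrier B. h (r \<odot>\<^bsub>B\<^esub> x) = r \<odot>\<^bsub>C\<^esub> h x}"

definition smooth_functions :: "nat \<Rightarrow> 'm topology \<Rightarrow> 'm chart set \<Rightarrow> (real, 'm \<Rightarrow> real) module" where
  "smooth_functions n M \<A> =
    \<lparr>carrier = {f \<in> extensional (topspace M).
                 \<forall>(U, \<phi>)\<in>\<A>. smooth_on n (\<phi> ` U) (\<lambda>x. f (inv_into U \<phi> x))},
     mult = (\<lambda>f g. \<lambda>x\<in>topspace M. f x * g x),
     one = (\<lambda>x\<in>topspace M. 1),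
     zero = (\<lambda>x\<in>topspace M. 0),
     add = (\<lambda>f g. \<lambda>x\<in>topspace M. f x + g x),
     smult = (\<lambda>r f. \<lambda>x\<in>topspace M. r * f x)\<rparr>"

definition fibre_product ::
  "(real, 'a) module \<Rightarrow> (real, 'b) module \<Rightarrow> ('a \<Rightarrow> 'c) \<Rightarrow> ('b \<Rightarrow> 'c) \<Rightarrow> (real, 'a \<times> 'b) module" where
  "fibre_product A1 A2 p1 p2 =
    \<lparr>carrier = {(a1, a2). a1 \<in> carrier A1 \<and> a2 \<in> carrier A2 \<and> p1 a1 = p2 a2},
     mult = (\<lambda>(a1, a2) (b1, b2). (a1 \<otimes>\<^bsub>A1\<^esub> b1, a2 \<otimes>\<^bsub>A2\<^esub> b2)),
     one = (\<one>\<^bsub>A1\<^esub>, \<one>\<^bsub>A2\<^esub>),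
     zero = (\<zero>\<^bsub>A1\<^esub>, \<zero>\<^bsub>A2\<^esub>),
     add = (\<lambda>(a1, a2) (b1, b2). (a1 \<oplus>\<^bsub>A1\<^esub> b1, a2 \<oplus>\<^bsub>A2\<^esub> b2)),
     smult = (\<lambda>r (a1, a2). (r \<odot>\<^bsub>A1\<^esub> a1, r \<odot>\<^bsub>A2\<^esub> a2))\<rparr>"


section \<open>Real spectrum\<close>

text \<open>Points are normalised to be \<^const>\<open>undefined\<close> off the carrier, so that equality of points is
  equality of homomorphisms on the carrier.\<close>

definition Spec :: "(real, 'b) module \<Rightarrow> ('b \<Rightarrow> real) set" where
  "Spec B = alg_hom B real_alg \<inter> extensional (carrier B)"

definition zariski :: "(real, 'b) module \<Rightarrow> ('b \<Rightarrow> real) topology" where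
  "zariski B = topology_generated_by ((\<lambda>b. {h \<in> Spec B. h b \<noteq> 0}) ` carrier B)"

definition Spec_map :: "(real, 'b) module \<Rightarrow> ('b \<Rightarrow> 'c) \<Rightarrow> ('c \<Rightarrow> real) \<Rightarrow> ('b \<Rightarrow> real)" where
  "Spec_map B \<phi> h = compose (carrier B) h \<phi>"


section \<open>Linear differential operators\<close>

definition linear_maps :: "(real, 'b) module \<Rightarrow> (real, 'c) module \<Rightarrow> ('b \<Rightarrow> 'c) set" where
  "linear_maps B C = {\<Delta> \<in> carrier B \<rightarrow>\<^sub>E carrier C.
     (\<forall>x\<in>carrier B. \<forall>y\<in>carrier B. \<Delta> (x \<oplus>\<^bsub>B\<^esub> y) = \<Delta> x \<oplus>\<^bsub>C\<^esub> \<Delta> y) \<and>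
     (\<forall>r. \<forall>x\<in>carrier B. \<Delta> (r \<odot>\<^bsub>B\<^esub> x) = r \<odot>\<^bsub>C\<^esub> \<Delta> x)}"

definition delta :: "(real, 'b) module \<Rightarrow> 'b \<Rightarrow> ('b \<Rightarrow> 'b) \<Rightarrow> ('b \<Rightarrow> 'b)" where
  "delta B b \<Delta> = (\<lambda>x\<in>carrier B. \<Delta> (b \<otimes>\<^bsub>B\<^esub> x) \<ominus>\<^bsub>B\<^esub> b \<otimes>\<^bsub>B\<^esub> \<Delta> x)"

text \<open>For \<open>bs = [b\<^sub>0, \<dots>, b\<^sub>k]\<close>, \<open>foldr (delta B) bs\<close> is the composite
  \<open>\<delta>\<^bsub>b\<^sub>0\<^esub> \<circ> \<dots> \<circ> \<delta>\<^bsub>b\<^sub>k\<^esub>\<close>.\<close>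

definition Diff :: "nat \<Rightarrow> (real, 'b) module \<Rightarrow> ('b \<Rightarrow> 'b) set" where
  "Diff k B = {\<Delta> \<in> linear_maps B B.
     \<forall>bs. length bs = k + 1 \<and> set bs \<subseteq> carrier B \<longrightarrow>
       foldr (delta B) bs \<Delta> = (\<lambda>x\<in>carrier B. \<zero>\<^bsub>B\<^esub>)}"

definition is_component_pair ::
  "(real, 'a) module \<Rightarrow> (real, 'b) module \<Rightarrow> (real, 'a \<times> 'b) module \<Rightarrow>
   ('a \<times> 'b \<Rightarrow> 'a \<times> 'b) \<Rightarrow> ('a \<Rightarrow> 'a) \<times> ('b \<Rightarrow> 'b) \<Rightarrow> bool" where
  "is_component_pair A1 A2 A \<Delta> = (\<lambda>(\<Delta>1, \<Delta>2).
     \<Delta>1 \<in> linear_maps A1 A1 \<and> \<Delta>2 \<in> linear_maps A2 A2 \<and>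
     (\<forall>a\<in>carrier A. fst (\<Delta> a) = \<Delta>1 (fst a) \<and> snd (\<Delta> a) = \<Delta>2 (snd a)))"

end

theory Submission
  imports Defs
begin

text \<open>
  The projections of the fibre product \<open>A\<close> onto its two factors are surjective, because \<open>p1\<close> and
  \<open>p2\<close> are. Hence a linear map \<open>\<Delta>\<close> of \<open>A\<close> has at most one component on each factor, and it has
  one exactly when it maps the kernel of each projection into itself. Once components exist, the
  rest is formal: both projections commute with the commutators \<open>\<delta>\<^sub>b\<close> (\<open>foldr_delta_intertwines\<close>),
  so the order of an operator passes from \<open>\<Delta>\<close> to its components by surjectivity
  (\<open>Diff_descends\<close>), and from the components to \<open>\<Delta>\<close> because the two projections are jointly
  injective (\<open>Diff_from_components\<close>).

  What has to be shown is thus that a differential operator preserves the kernels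
  (\<open>Diff_preserves_kernel\<close>). Let \<open>fst a = 0\<close> and suppose that \<open>\<Delta> a\<close> does not vanish at some point
  of the image \<open>X\<close> of the first spectrum in the spectrum of \<open>A\<close>. Since \<open>X\<close> is the closure of its
  interior, \<open>\<Delta> a\<close> is nonzero at some interior point \<open>g\<close> of \<open>X\<close>, and a basic open neighbourhood of \<open>g\<close>
  within \<open>X\<close> provides an element \<open>b\<close> with \<open>g b \<noteq> 0\<close> that vanishes outside \<open>X\<close>. As \<open>a\<close> vanishes on
  \<open>X\<close>, the product \<open>b a\<close> vanishes at all points, and so it is \<open>0\<close>. For \<open>b a = 0\<close> the iterated
  commutator collapses to its last term, \<open>(\<delta>\<^sub>b ^ (k + 1)) \<Delta> a = (- b) ^ (k + 1) \<Delta> a\<close>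
  (\<open>foldr_delta_annihilated\<close>). The left-hand side is \<open>0\<close> for an operator of order \<open>k\<close>, whereas the
  right-hand side is nonzero at \<open>g\<close>.

  The argument concerns any two real algebras whose elements are determined by their values
  at the points of the spectrum. Smooth functions enter only through this property, which
  the evaluations at the points of the manifold guarantee (\<open>smooth_functions_geometric\<close>), and
  through the closure of smoothness under sums and products (\<open>smooth_functions_algebra\<close>).
\<close>

section \<open>The real algebra structure\<close>

lemma real_alg_simps [simp]:
  "carrier real_alg = UNIV" "x \<otimes>\<^bsub>real_alg\<^esub> y = x * y" "\<one>\<^bsub>real_alg\<^esub> = 1"
  "\<zero>\<^bsub>real_alg\<^esub> = 0" "x \<oplus>\<^bsub>real_alg\<^esub> y = x + y" "x \<odot>\<^bsub>real_alg\<^esub> y = x * y"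
  by (simp_all add: real_alg_def)

lemma real_alg_cring: "cring real_alg"
proof (intro cringI abelian_groupI comm_monoidI)
  show "\<exists>y\<in>carrier real_alg. y \<oplus>\<^bsub>real_alg\<^esub> x = \<zero>\<^bsub>real_alg\<^esub>" for x
    by (auto intro!: exI[of _ "- x"])
qed (auto simp: algebra_simps)

lemma real_alg_algebra: "Module.algebra real_alg real_alg"
  by (intro algebraI real_alg_cring) (auto simp: algebra_simps)

lemma alg_homD:
  assumes "\<phi> \<in> alg_hom B C"
  shows "x \<in> carrier B \<Longrightarrow> \<phi> x \<in> carrier C"
    and "x \<in> carrier B \<Longrightarrow> y \<in> carrier B \<Longrightarrow> \<phi> (x \<otimes>\<^bsub>B\<^esub> y) = \<phi> x \<otimes>\<^bsub>C\<^esub> \<phi> y"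
    and "x \<in> carrier B \<Longrightarrow> y \<in> carrier B \<Longrightarrow> \<phi> (x \<oplus>\<^bsub>B\<^esub> y) = \<phi> x \<oplus>\<^bsub>C\<^esub> \<phi> y"
    and "\<phi> \<one>\<^bsub>B\<^esub> = \<one>\<^bsub>C\<^esub>"
    and "x \<in> carrier B \<Longrightarrow> \<phi> (r \<odot>\<^bsub>B\<^esub> x) = r \<odot>\<^bsub>C\<^esub> \<phi> x"
  using assms by (auto simp: alg_hom_def ring_hom_def)

lemma alg_hom_zero_minus:
  assumes B: "Module.algebra real_alg B" and C: "Module.algebra real_alg C"
    and \<phi>: "\<phi> \<in> alg_hom B C"
  shows "\<phi> \<zero>\<^bsub>B\<^esub> = \<zero>\<^bsub>C\<^esub>"
    and "x \<in> carrier B \<Longrightarrow> y \<in> carrier B \<Longrightarrow> \<phi> (x \<ominus>\<^bsub>B\<^esub> y) = \<phi> x \<ominus>\<^bsub>C\<^esub> \<phi> y"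
proof -
  interpret B: cring B using B by (rule Module.algebra.M_cring)
  interpret C: cring C using C by (rule Module.algebra.M_cring)
  interpret ring_hom_cring B C \<phi>
    by unfold_locales (use \<phi> in \<open>simp add: alg_hom_def\<close>)
  show "\<phi> \<zero>\<^bsub>B\<^esub> = \<zero>\<^bsub>C\<^esub>" by simp
  show "x \<in> carrier B \<Longrightarrow> y \<in> carrier B \<Longrightarrow> \<phi> (x \<ominus>\<^bsub>B\<^esub> y) = \<phi> x \<ominus>\<^bsub>C\<^esub> \<phi> y"
    by (simp add: a_minus_def)
qed

lemma real_alg_minus: "x \<ominus>\<^bsub>real_alg\<^esub> y = x - y"
proof -
  interpret cring real_alg by (rule real_alg_cring)
  have "\<ominus>\<^bsub>real_alg\<^esub> y = - y" by (rule minus_equality) auto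
  then show ?thesis by (simp add: a_minus_def)
qed

lemma SpecD:
  assumes B: "Module.algebra real_alg B" and h: "h \<in> Spec B"
  shows "x \<in> carrier B \<Longrightarrow> y \<in> carrier B \<Longrightarrow> h (x \<otimes>\<^bsub>B\<^esub> y) = h x * h y"
    and "x \<in> carrier B \<Longrightarrow> y \<in> carrier B \<Longrightarrow> h (x \<ominus>\<^bsub>B\<^esub> y) = h x - h y"
    and "h \<zero>\<^bsub>B\<^esub> = 0"
proof -
  have *: "h \<in> alg_hom B real_alg" using h by (simp add: Spec_def)
  show "x \<in> carrier B \<Longrightarrow> y \<in> carrier B \<Longrightarrow> h (x \<otimes>\<^bsub>B\<^esub> y) = h x * h y"
    using alg_homD(2)[OF *] by simp
  show "x \<in> carrier B \<Longrightarrow> y \<in> carrier B \<Longrightarrow> h (x \<ominus>\<^bsub>B\<^esub> y) = h x - h y"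
    using alg_hom_zero_minus(2)[OF B real_alg_algebra *] by (simp add: real_alg_minus)
  show "h \<zero>\<^bsub>B\<^esub> = 0"
    using alg_hom_zero_minus(1)[OF B real_alg_algebra *] by simp
qed

lemma Spec_map_in_Spec:
  assumes B: "Module.algebra real_alg B" and \<phi>: "\<phi> \<in> alg_hom B C" and h: "h \<in> Spec C"
  shows "Spec_map B \<phi> h \<in> Spec B"
proof -
  interpret B: Module.algebra real_alg B by (rule B)
  have h': "h \<in> alg_hom C real_alg" using h by (simp add: Spec_def)
  show ?thesis
    unfolding Spec_def Spec_map_def alg_hom_def
    using alg_homD[OF \<phi>] alg_homD[OF h'] B.smult_closed
    by (auto simp: compose_def intro!: ring_hom_memI)
qed


section \<open>The Zariski topology\<close>

lemma openin_zariski_basic: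
  "b \<in> carrier B \<Longrightarrow> openin (zariski B) {h \<in> Spec B. h b \<noteq> 0}"
  unfolding zariski_def by (rule topology_generated_by_Basis) auto

text \<open>The generating sets form a base, since the nonvanishing sets of \<open>b\<close> and \<open>c\<close> intersect in that
  of \<open>b c\<close>: real numbers have no zero divisors.\<close>

lemma zariski_basic_nbhd:
  assumes B: "Module.algebra real_alg B"
    and W: "openin (zariski B) W" and h: "h \<in> W"
  obtains b where "b \<in> carrier B" "h b \<noteq> 0" "{g \<in> Spec B. g b \<noteq> 0} \<subseteq> W"
proof -
  interpret B: cring B using B by (rule Module.algebra.M_cring)
  have W': "generate_topology_on ((\<lambda>b. {h \<in> Spec B. h b \<noteq> 0}) ` carrier B) W"
    using W unfolding zariski_def by (rule openin_topology_generated_by)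
  then have "\<forall>h\<in>W. h \<in> Spec B \<and> (\<exists>b\<in>carrier B. h b \<noteq> 0 \<and> {g \<in> Spec B. g b \<noteq> 0} \<subseteq> W)"
  proof induction
    case (Int V W)
    show ?case
    proof
      fix h assume h: "h \<in> V \<inter> W"
      then obtain b c where bc: "b \<in> carrier B" "h b \<noteq> 0" "{g \<in> Spec B. g b \<noteq> 0} \<subseteq> V"
        "c \<in> carrier B" "h c \<noteq> 0" "{g \<in> Spec B. g c \<noteq> 0} \<subseteq> W" and hS: "h \<in> Spec B"
        using Int.IH by blast
      have mult: "g (b \<otimes>\<^bsub>B\<^esub> c) = g b * g c" if "g \<in> Spec B" for g
        by (rule SpecD(1)[OF B that bc(1,4)])
      have "{g \<in> Spec B. g (b \<otimes>\<^bsub>B\<^esub> c) \<noteq> 0} \<subseteq> V \<inter> W"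
      proof
        fix g assume "g \<in> {g \<in> Spec B. g (b \<otimes>\<^bsub>B\<^esub> c) \<noteq> 0}"
        then have "g \<in> Spec B" "g b \<noteq> 0" "g c \<noteq> 0" using mult[of g] by auto
        then show "g \<in> V \<inter> W" using bc(3,6) by auto
      qed
      moreover have "h (b \<otimes>\<^bsub>B\<^esub> c) \<noteq> 0" using bc mult[OF hS] by simp
      moreover have "b \<otimes>\<^bsub>B\<^esub> c \<in> carrier B" using bc by simp
      ultimately show "h \<in> Spec B \<and> (\<exists>b\<in>carrier B. h b \<noteq> 0 \<and> {g \<in> Spec B. g b \<noteq> 0} \<subseteq> V \<inter> W)"
        using hS by (intro conjI bexI)
    qed
  next
    case (UN K)
    show ?case
    proof
      fix h assume "h \<in> \<Union>K"
      then obtain V where V: "V \<in> K" "h \<in> V" by blast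
      then obtain b where b: "h \<in> Spec B" "b \<in> carrier B" "h b \<noteq> 0" "{g \<in> Spec B. g b \<noteq> 0} \<subseteq> V"
        using UN.IH by meson
      moreover have "V \<subseteq> \<Union>K" using V(1) by (rule Union_upper)
      ultimately show "h \<in> Spec B \<and> (\<exists>b\<in>carrier B. h b \<noteq> 0 \<and> {g \<in> Spec B. g b \<noteq> 0} \<subseteq> \<Union>K)"
        by (meson subset_trans)
    qed
  qed auto
  then show thesis using h that by meson
qed


section \<open>Differential operators\<close>

lemma linear_mapsD:
  assumes "\<Delta> \<in> linear_maps B C"
  shows "x \<in> carrier B \<Longrightarrow> \<Delta> x \<in> carrier C"
    and "x \<in> carrier B \<Longrightarrow> y \<in> carrier B \<Longrightarrow> \<Delta> (x \<oplus>\<^bsub>B\<^esub> y) = \<Delta> x \<oplus>\<^bsub>C\<^esub> \<Delta> y"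
    and "x \<in> carrier B \<Longrightarrow> \<Delta> (r \<odot>\<^bsub>B\<^esub> x) = r \<odot>\<^bsub>C\<^esub> \<Delta> x"
    and "\<Delta> \<in> extensional (carrier B)"
  using assms by (auto simp: linear_maps_def PiE_iff)

lemma linear_maps_zero:
  assumes B: "Module.algebra real_alg B" and C: "Module.algebra real_alg C"
    and \<Delta>: "\<Delta> \<in> linear_maps B C"
  shows "\<Delta> \<zero>\<^bsub>B\<^esub> = \<zero>\<^bsub>C\<^esub>"
proof -
  interpret B: Module.algebra real_alg B by (rule B)
  interpret C: Module.algebra real_alg C by (rule C)
  have "\<Delta> (0 \<odot>\<^bsub>B\<^esub> \<zero>\<^bsub>B\<^esub>) = 0 \<odot>\<^bsub>C\<^esub> \<Delta> \<zero>\<^bsub>B\<^esub>"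
    by (rule linear_mapsD(3)[OF \<Delta>]) simp
  moreover have "\<Delta> \<zero>\<^bsub>B\<^esub> \<in> carrier C" using linear_mapsD(1)[OF \<Delta>] by simp
  ultimately show ?thesis
    using B.smult_l_null[of "\<zero>\<^bsub>B\<^esub>"] C.smult_l_null[of "\<Delta> \<zero>\<^bsub>B\<^esub>"] by simp
qed

lemma delta_linear:
  assumes B: "Module.algebra real_alg B" and b: "b \<in> carrier B" and \<Delta>: "\<Delta> \<in> linear_maps B B"
  shows "delta B b \<Delta> \<in> linear_maps B B"
proof -
  interpret B: Module.algebra real_alg B by (rule B)
  note D = linear_mapsD[OF \<Delta>]
  have add: "delta B b \<Delta> (x \<oplus>\<^bsub>B\<^esub> y) = delta B b \<Delta> x \<oplus>\<^bsub>B\<^esub> delta B b \<Delta> y"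
    if "x \<in> carrier B" "y \<in> carrier B" for x y
    using that b D(1) by (simp add: delta_def D(2) B.r_distr B.M.minus_eq B.M.minus_add B.M.add.m_ac)
  have smult: "delta B b \<Delta> (r \<odot>\<^bsub>B\<^esub> x) = r \<odot>\<^bsub>B\<^esub> delta B b \<Delta> x" if x: "x \<in> carrier B" for r x
  proof -
    have [simp]: "r \<odot>\<^bsub>B\<^esub> y \<in> carrier B" if "y \<in> carrier B" for y
      using B.smult_closed[of r y] that by simp
    have comm: "b \<otimes>\<^bsub>B\<^esub> (r \<odot>\<^bsub>B\<^esub> y) = r \<odot>\<^bsub>B\<^esub> (b \<otimes>\<^bsub>B\<^esub> y)" if "y \<in> carrier B" for y
      using that b B.smult_assoc2[of r y b] by (simp add: B.m_comm)
    show ?thesis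
      using x b D(1) B.smult_r_distr[of r] B.smult_r_minus[of r]
      by (simp add: delta_def comm D(3) B.M.minus_eq)
  qed
  show ?thesis
    unfolding linear_maps_def using b add smult D(1) by (auto simp: delta_def)
qed

lemma foldr_delta_linear:
  assumes B: "Module.algebra real_alg B" and bs: "set bs \<subseteq> carrier B" and \<Delta>: "\<Delta> \<in> linear_maps B B"
  shows "foldr (delta B) bs \<Delta> \<in> linear_maps B B"
  using bs by (induction bs) (auto intro: delta_linear[OF B] simp: \<Delta>)

text \<open>If \<open>b a = 0\<close> then \<open>\<delta>\<^sub>b E a = E (b a) - b E a = - b E a\<close> for every linear \<open>E\<close>, so each commutator
  contributes a factor \<open>- b\<close>. Reading the result at a point \<open>h\<close> of the spectrum turns it into an
  identity of real numbers.\<close>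

lemma foldr_delta_annihilated:
  assumes B: "Module.algebra real_alg B" and \<Delta>: "\<Delta> \<in> linear_maps B B"
    and a: "a \<in> carrier B" and b: "b \<in> carrier B" and ba: "b \<otimes>\<^bsub>B\<^esub> a = \<zero>\<^bsub>B\<^esub>"
    and h: "h \<in> Spec B"
  shows "h (foldr (delta B) (replicate m b) \<Delta> a) = (- h b) ^ m * h (\<Delta> a)"
proof (induction m)
  case (Suc m)
  interpret B: Module.algebra real_alg B by (rule B)
  let ?E = "foldr (delta B) (replicate m b) \<Delta>"
  have E: "?E \<in> linear_maps B B"
    by (rule foldr_delta_linear[OF B _ \<Delta>]) (use b in auto)
  have "h (delta B b ?E a) = - h b * h (?E a)"
    using a b linear_maps_zero[OF B B E] linear_mapsD(1)[OF E]
    by (simp add: delta_def ba SpecD[OF B h])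
  moreover have "foldr (delta B) (replicate (Suc m) b) \<Delta> = delta B b ?E" by simp
  ultimately show ?case by (simp only: Suc.IH power_Suc mult.assoc)
qed simp

text \<open>The commutator with \<open>b\<close> is built from \<open>\<Delta>\<close>, multiplication by \<open>b\<close> and subtraction,
  all of which the homomorphism \<open>\<phi>\<close> carries over.\<close>

lemma foldr_delta_intertwines:
  assumes A: "Module.algebra real_alg A" and B: "Module.algebra real_alg B"
    and \<phi>: "\<phi> \<in> alg_hom A B" and \<Delta>: "\<Delta> \<in> linear_maps A A"
    and intertwines: "\<And>a. a \<in> carrier A \<Longrightarrow> \<phi> (\<Delta> a) = \<Delta>' (\<phi> a)"
    and bs: "set bs \<subseteq> carrier A" and a: "a \<in> carrier A"
  shows "\<phi> (foldr (delta A) bs \<Delta> a) = foldr (delta B) (map \<phi> bs) \<Delta>' (\<phi> a)"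
  using bs a
proof (induction bs arbitrary: a)
  case Nil
  then show ?case using intertwines by simp
next
  case (Cons b bs)
  interpret A: Module.algebra real_alg A by (rule A)
  have E: "foldr (delta A) bs \<Delta> \<in> linear_maps A A"
    by (rule foldr_delta_linear[OF A _ \<Delta>]) (use Cons.prems in auto)
  have ba: "b \<otimes>\<^bsub>A\<^esub> a \<in> carrier A" and b: "b \<in> carrier A" using Cons.prems by auto
  let ?E = "foldr (delta A) bs \<Delta>" and ?F = "foldr (delta B) (map \<phi> bs) \<Delta>'"
  note H = alg_homD[OF \<phi>] and E_closed = linear_mapsD(1)[OF E]
  have "\<phi> (foldr (delta A) (b # bs) \<Delta> a) = \<phi> (?E (b \<otimes>\<^bsub>A\<^esub> a) \<ominus>\<^bsub>A\<^esub> b \<otimes>\<^bsub>A\<^esub> ?E a)"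
    using Cons.prems by (simp add: delta_def[of A b])
  also have "\<dots> = \<phi> (?E (b \<otimes>\<^bsub>A\<^esub> a)) \<ominus>\<^bsub>B\<^esub> \<phi> b \<otimes>\<^bsub>B\<^esub> \<phi> (?E a)"
    using Cons.prems(2) b ba E_closed by (simp add: alg_hom_zero_minus(2)[OF A B \<phi>] H(2))
  also have "\<dots> = ?F (\<phi> b \<otimes>\<^bsub>B\<^esub> \<phi> a) \<ominus>\<^bsub>B\<^esub> \<phi> b \<otimes>\<^bsub>B\<^esub> ?F (\<phi> a)"
    using Cons.prems b ba by (simp add: Cons.IH H(2))
  also have "\<dots> = foldr (delta B) (map \<phi> (b # bs)) \<Delta>' (\<phi> a)"
    using H(1)[OF Cons.prems(2)] by (simp add: delta_def[of B "\<phi> b"])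
  finally show ?case .
qed

lemma DiffD:
  assumes "\<Delta> \<in> Diff k B"
  shows "\<Delta> \<in> linear_maps B B"
    and "length bs = k + 1 \<Longrightarrow> set bs \<subseteq> carrier B \<Longrightarrow> x \<in> carrier B \<Longrightarrow>
           foldr (delta B) bs \<Delta> x = \<zero>\<^bsub>B\<^esub>"
  using assms by (auto simp: Diff_def)

lemma DiffI:
  assumes B: "Module.algebra real_alg B" and \<Delta>: "\<Delta> \<in> linear_maps B B"
    and vanish: "\<And>bs x. length bs = k + 1 \<Longrightarrow> set bs \<subseteq> carrier B \<Longrightarrow> x \<in> carrier B \<Longrightarrow>
                   foldr (delta B) bs \<Delta> x = \<zero>\<^bsub>B\<^esub>"
  shows "\<Delta> \<in> Diff k B"
proof -
  have "foldr (delta B) bs \<Delta> = (\<lambda>x\<in>carrier B. \<zero>\<^bsub>B\<^esub>)"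
    if "length bs = k + 1" "set bs \<subseteq> carrier B" for bs
    using linear_mapsD(4)[OF foldr_delta_linear[OF B that(2) \<Delta>]]
    by (rule extensionalityI) (use vanish[OF that] in auto)
  then show ?thesis using \<Delta> by (simp add: Diff_def)
qed

lemma Diff_descends:
  assumes A: "Module.algebra real_alg A" and B: "Module.algebra real_alg B"
    and \<phi>: "\<phi> \<in> alg_hom A B" and surj: "\<phi> ` carrier A = carrier B"
    and \<Delta>: "\<Delta> \<in> Diff k A" and \<Delta>': "\<Delta>' \<in> linear_maps B B"
    and intertwines: "\<And>a. a \<in> carrier A \<Longrightarrow> \<phi> (\<Delta> a) = \<Delta>' (\<phi> a)"
  shows "\<Delta>' \<in> Diff k B"
proof (rule DiffI[OF B \<Delta>'])
  fix bs x assume bs: "length bs = k + 1" "set bs \<subseteq> carrier B" and x: "x \<in> carrier B"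
  \<comment> \<open>Testing \<open>\<Delta>'\<close> on \<open>bs\<close> and \<open>x\<close> amounts to testing \<open>\<Delta>\<close> on preimages of them.\<close>
  define cs where "cs = map (inv_into (carrier A) \<phi>) bs"
  have cs: "length cs = k + 1" "set cs \<subseteq> carrier A"
    using bs surj by (auto simp: cs_def intro!: inv_into_into)
  have map_cs: "map \<phi> cs = bs"
    unfolding cs_def using bs surj by (auto simp: f_inv_into_f intro!: map_idI)
  obtain a where a: "a \<in> carrier A" "x = \<phi> a" using x surj by auto
  show "foldr (delta B) bs \<Delta>' x = \<zero>\<^bsub>B\<^esub>"
    using foldr_delta_intertwines[where \<Delta>'=\<Delta>', OF A B \<phi> DiffD(1)[OF \<Delta>] intertwines cs(2) a(1)]
      DiffD(2)[OF \<Delta> cs a(1)] alg_hom_zero_minus(1)[OF A B \<phi>]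
    by (simp add: map_cs a(2))
qed

lemma linear_map_descends:
  assumes A: "Module.algebra real_alg A" and B: "Module.algebra real_alg B"
    and \<phi>: "\<phi> \<in> alg_hom A B" and surj: "\<phi> ` carrier A = carrier B"
    and \<Delta>: "\<Delta> \<in> linear_maps A A"
    and ker: "\<And>a. a \<in> carrier A \<Longrightarrow> \<phi> a = \<zero>\<^bsub>B\<^esub> \<Longrightarrow> \<phi> (\<Delta> a) = \<zero>\<^bsub>B\<^esub>"
  obtains \<Delta>' where "\<Delta>' \<in> linear_maps B B" "\<And>a. a \<in> carrier A \<Longrightarrow> \<phi> (\<Delta> a) = \<Delta>' (\<phi> a)"
proof
  interpret A: Module.algebra real_alg A by (rule A)
  interpret B: Module.algebra real_alg B by (rule B)
  note H = alg_homD[OF \<phi>] and D = linear_mapsD[OF \<Delta>]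
  have smultA: "r \<odot>\<^bsub>A\<^esub> x \<in> carrier A" if "x \<in> carrier A" for r x
    using A.smult_closed[of r x] that by simp
  have well_defined: "\<phi> (\<Delta> x) = \<phi> (\<Delta> y)"
    if xy: "x \<in> carrier A" "y \<in> carrier A" and eq: "\<phi> x = \<phi> y" for x y
  proof -
    have d: "x \<ominus>\<^bsub>A\<^esub> y \<in> carrier A" using xy by simp
    have "\<phi> (x \<ominus>\<^bsub>A\<^esub> y) = \<zero>\<^bsub>B\<^esub>"
      using xy H(1) by (simp add: alg_hom_zero_minus(2)[OF A B \<phi>] eq B.M.minus_eq B.M.r_neg)
    then have "\<phi> (\<Delta> (x \<ominus>\<^bsub>A\<^esub> y)) = \<zero>\<^bsub>B\<^esub>" by (rule ker[OF d])
    moreover have "x = (x \<ominus>\<^bsub>A\<^esub> y) \<oplus>\<^bsub>A\<^esub> y"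
      using xy by (simp add: A.M.minus_eq A.M.a_assoc A.M.l_neg)
    then have "\<phi> (\<Delta> x) = \<phi> (\<Delta> (x \<ominus>\<^bsub>A\<^esub> y)) \<oplus>\<^bsub>B\<^esub> \<phi> (\<Delta> y)"
      using D(2)[OF d xy(2)] H(3)[OF D(1)[OF d] D(1)[OF xy(2)]] by metis
    ultimately show ?thesis using H(1)[OF D(1)[OF xy(2)]] by simp
  qed
  define \<Delta>' where "\<Delta>' = (\<lambda>x\<in>carrier B. \<phi> (\<Delta> (inv_into (carrier A) \<phi> x)))"
  show intertwines: "\<phi> (\<Delta> a) = \<Delta>' (\<phi> a)" if "a \<in> carrier A" for a
    unfolding \<Delta>'_def using that H(1)
    by (auto intro!: well_defined inv_into_into simp: f_inv_into_f)
  have add: "\<Delta>' (x \<oplus>\<^bsub>B\<^esub> y) = \<Delta>' x \<oplus>\<^bsub>B\<^esub> \<Delta>' y" if xy: "x \<in> carrier B" "y \<in> carrier B" for x y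
  proof -
    obtain a b where ab: "a \<in> carrier A" "b \<in> carrier A" "x = \<phi> a" "y = \<phi> b"
      using xy surj by (metis imageE)
    then show ?thesis
      using D(1,2) intertwines[of "a \<oplus>\<^bsub>A\<^esub> b"] by (simp add: H intertwines)
  qed
  have smult: "\<Delta>' (r \<odot>\<^bsub>B\<^esub> x) = r \<odot>\<^bsub>B\<^esub> \<Delta>' x" if x: "x \<in> carrier B" for r x
  proof -
    obtain a where a: "a \<in> carrier A" "x = \<phi> a" using x surj by (metis imageE)
    then show ?thesis
      using D(1,3) intertwines[of "r \<odot>\<^bsub>A\<^esub> a"] smultA by (simp add: H intertwines)
  qed
  have "\<Delta>' x \<in> carrier B" if x: "x \<in> carrier B" for x
  proof -
    obtain a where a: "a \<in> carrier A" "x = \<phi> a" using x surj by (metis imageE)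
    then show ?thesis using H(1)[OF D(1)[OF a(1)]] intertwines[OF a(1)] by simp
  qed
  then show "\<Delta>' \<in> linear_maps B B"
    unfolding linear_maps_def using add smult by (auto simp: \<Delta>'_def)
qed


section \<open>Locality\<close>

text \<open>Geometric algebras are those that embed into the algebra of real functions on their spectrum.\<close>

definition geometric :: "(real, 'b) module \<Rightarrow> bool" where
  "geometric B \<longleftrightarrow> (\<forall>x\<in>carrier B. (\<forall>h\<in>Spec B. h x = 0) \<longrightarrow> x = \<zero>\<^bsub>B\<^esub>)"

text \<open>Differential operators are local. The kernel of \<open>\<phi>\<close> consists of the elements that vanish on the
  image of \<open>|\<phi>|\<close>, so locality yields the claim at interior points of this image, and the
  closure hypothesis extends it to the whole image. The second homomorphism \<open>\<phi>'\<close> serves to recognise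
  \<open>0\<close> in \<open>A\<close>. For a fibre product, \<open>\<phi>\<close> and \<open>\<phi>'\<close> are the two
  projections, in either order.\<close>

lemma Diff_preserves_kernel:
  assumes A: "Module.algebra real_alg A" and B: "Module.algebra real_alg B"
    and B': "Module.algebra real_alg B'"
    and \<phi>: "\<phi> \<in> alg_hom A B" and \<phi>': "\<phi>' \<in> alg_hom A B'"
    and jointly_inj: "\<And>a. a \<in> carrier A \<Longrightarrow> \<phi> a = \<zero>\<^bsub>B\<^esub> \<Longrightarrow> \<phi>' a = \<zero>\<^bsub>B'\<^esub> \<Longrightarrow> a = \<zero>\<^bsub>A\<^esub>"
    and geometric: "geometric B" "geometric B'"
    and closure: "(zariski A) closure_of ((zariski A) interior_of (Spec_map A \<phi> ` Spec B))
                    = Spec_map A \<phi> ` Spec B"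
    and \<Delta>: "\<Delta> \<in> Diff k A" and a: "a \<in> carrier A" and ker: "\<phi> a = \<zero>\<^bsub>B\<^esub>"
  shows "\<phi> (\<Delta> a) = \<zero>\<^bsub>B\<^esub>"
proof (rule ccontr)
  interpret A: Module.algebra real_alg A by (rule A)
  interpret B: Module.algebra real_alg B by (rule B)
  let ?X = "Spec_map A \<phi> ` Spec B"
  note \<Delta>a = linear_mapsD(1)[OF DiffD(1)[OF \<Delta>] a]
  assume "\<phi> (\<Delta> a) \<noteq> \<zero>\<^bsub>B\<^esub>"
  then obtain h where h: "h \<in> Spec B" "h (\<phi> (\<Delta> a)) \<noteq> 0"
    using geometric(1) alg_homD(1)[OF \<phi> \<Delta>a] by (auto simp: geometric_def)
  let ?U = "{g \<in> Spec A. g (\<Delta> a) \<noteq> 0}"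
  have "Spec_map A \<phi> h \<in> ?U"
    using Spec_map_in_Spec[OF A \<phi> h(1)] h(2) \<Delta>a by (simp add: Spec_map_def compose_def)
  moreover have "Spec_map A \<phi> h \<in> (zariski A) closure_of ((zariski A) interior_of ?X)"
    using h(1) closure by simp
  ultimately obtain g where g: "g \<in> (zariski A) interior_of ?X" "g \<in> ?U"
    using openin_zariski_basic[OF \<Delta>a] unfolding in_closure_of by meson
  obtain b where b: "b \<in> carrier A" "g b \<noteq> 0"
    and "{f \<in> Spec A. f b \<noteq> 0} \<subseteq> (zariski A) interior_of ?X"
    by (rule zariski_basic_nbhd[OF A openin_interior_of g(1)])
  then have b_supp: "{f \<in> Spec A. f b \<noteq> 0} \<subseteq> ?X"
    by (meson interior_of_subset subset_trans)
  \<comment> \<open>At a point \<open>h'\<close> of the second spectrum either \<open>b\<close> vanishes, or the image of \<open>h'\<close> lies in \<open>?X\<close>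
    and \<open>a\<close> vanishes.\<close>
  have "b \<otimes>\<^bsub>A\<^esub> a = \<zero>\<^bsub>A\<^esub>"
  proof (rule jointly_inj)
    show ba: "b \<otimes>\<^bsub>A\<^esub> a \<in> carrier A" using a b by simp
    show "\<phi> (b \<otimes>\<^bsub>A\<^esub> a) = \<zero>\<^bsub>B\<^esub>"
      using a b alg_homD(1)[OF \<phi>] by (simp add: alg_homD(2)[OF \<phi>] ker)
    have "h' (\<phi>' (b \<otimes>\<^bsub>A\<^esub> a)) = 0" if h': "h' \<in> Spec B'" for h'
    proof -
      have eval: "h' (\<phi>' c) = Spec_map A \<phi>' h' c" if "c \<in> carrier A" for c
        using that by (simp add: Spec_map_def compose_def)
      have S: "Spec_map A \<phi>' h' \<in> Spec A" by (rule Spec_map_in_Spec[OF A \<phi>' h'])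
      have "Spec_map A \<phi>' h' a = 0" if nz: "Spec_map A \<phi>' h' b \<noteq> 0"
      proof -
        obtain f where f: "f \<in> Spec B" "Spec_map A \<phi>' h' = Spec_map A \<phi> f"
          using b_supp S nz by blast
        then show ?thesis
          using a ker SpecD(3)[OF B f(1)] by (simp add: Spec_map_def compose_def)
      qed
      then show ?thesis
        unfolding eval[OF ba] SpecD(1)[OF A S b(1) a] by auto
    qed
    then show "\<phi>' (b \<otimes>\<^bsub>A\<^esub> a) = \<zero>\<^bsub>B'\<^esub>"
      using geometric(2) alg_homD(1)[OF \<phi>' ba] by (simp add: geometric_def)
  qed
  moreover have gS: "g \<in> Spec A" using g by simp
  ultimately have "g (foldr (delta A) (replicate (k + 1) b) \<Delta> a) = (- g b) ^ (k + 1) * g (\<Delta> a)"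
    by (intro foldr_delta_annihilated[OF A DiffD(1)[OF \<Delta>] a b(1)])
  moreover have "foldr (delta A) (replicate (k + 1) b) \<Delta> a = \<zero>\<^bsub>A\<^esub>"
    by (rule DiffD(2)[OF \<Delta> _ _ a]) (use b in auto)
  ultimately show False
    using SpecD(3)[OF A gS] b(2) g(2) by simp
qed


section \<open>Fibre products\<close>

locale fibre_square =
  fixes A1 :: "(real, 'a) module" and A2 :: "(real, 'b) module" and C :: "(real, 'c) module"
    and p1 :: "'a \<Rightarrow> 'c" and p2 :: "'b \<Rightarrow> 'c" and A :: "(real, 'a \<times> 'b) module"
  assumes A1: "Module.algebra real_alg A1" and A2: "Module.algebra real_alg A2"
    and C: "Module.algebra real_alg C"
    and p1: "p1 \<in> alg_hom A1 C" and p1_surj: "p1 ` carrier A1 = carrier C"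
    and p2: "p2 \<in> alg_hom A2 C" and p2_surj: "p2 ` carrier A2 = carrier C"
    and A_eq: "A = fibre_product A1 A2 p1 p2"
begin

interpretation A1: Module.algebra real_alg A1 by (rule A1)
interpretation A2: Module.algebra real_alg A2 by (rule A2)
interpretation C: Module.algebra real_alg C by (rule C)

lemma A_simps:
  "a \<in> carrier A \<longleftrightarrow> fst a \<in> carrier A1 \<and> snd a \<in> carrier A2 \<and> p1 (fst a) = p2 (snd a)"
  "a \<otimes>\<^bsub>A\<^esub> b = (fst a \<otimes>\<^bsub>A1\<^esub> fst b, snd a \<otimes>\<^bsub>A2\<^esub> snd b)"
  "a \<oplus>\<^bsub>A\<^esub> b = (fst a \<oplus>\<^bsub>A1\<^esub> fst b, snd a \<oplus>\<^bsub>A2\<^esub> snd b)"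
  "\<one>\<^bsub>A\<^esub> = (\<one>\<^bsub>A1\<^esub>, \<one>\<^bsub>A2\<^esub>)" "\<zero>\<^bsub>A\<^esub> = (\<zero>\<^bsub>A1\<^esub>, \<zero>\<^bsub>A2\<^esub>)"
  "r \<odot>\<^bsub>A\<^esub> a = (r \<odot>\<^bsub>A1\<^esub> fst a, r \<odot>\<^bsub>A2\<^esub> snd a)"
  by (simp_all add: A_eq fibre_product_def case_prod_beta)

lemma smult_closed12:
  "x \<in> carrier A1 \<Longrightarrow> r \<odot>\<^bsub>A1\<^esub> x \<in> carrier A1" "y \<in> carrier A2 \<Longrightarrow> r \<odot>\<^bsub>A2\<^esub> y \<in> carrier A2"
  using A1.smult_closed[of r x] A2.smult_closed[of r y] by simp_all

lemma A_algebra: "Module.algebra real_alg A"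
proof (intro algebraI real_alg_cring)
  note hom = alg_homD[OF p1] alg_homD[OF p2]
    alg_hom_zero_minus[OF A1 C p1] alg_hom_zero_minus[OF A2 C p2]
  show "cring A"
  proof (intro cringI abelian_groupI comm_monoidI)
    show "\<exists>y\<in>carrier A. y \<oplus>\<^bsub>A\<^esub> x = \<zero>\<^bsub>A\<^esub>" if x: "x \<in> carrier A" for x
    proof
      let ?y = "(\<zero>\<^bsub>A1\<^esub> \<ominus>\<^bsub>A1\<^esub> fst x, \<zero>\<^bsub>A2\<^esub> \<ominus>\<^bsub>A2\<^esub> snd x)"
      show "?y \<in> carrier A" using x by (simp add: A_simps hom)
      show "?y \<oplus>\<^bsub>A\<^esub> x = \<zero>\<^bsub>A\<^esub>"
        using x by (simp add: A_simps A1.M.minus_eq A2.M.minus_eq A1.M.l_neg A2.M.l_neg)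
    qed
  qed (auto simp: A_simps hom A1.M.add.m_ac A2.M.add.m_ac A1.m_assoc A2.m_assoc
         A1.l_distr A2.l_distr intro: A1.m_comm A2.m_comm)
qed (auto simp: A_simps smult_closed12 alg_homD[OF p1] alg_homD[OF p2]
      A1.smult_r_distr A2.smult_r_distr A1.smult_assoc2 A2.smult_assoc2
      A1.smult_l_distr[simplified] A2.smult_l_distr[simplified]
      A1.smult_assoc1[simplified] A2.smult_assoc1[simplified]
      A1.smult_one[simplified] A2.smult_one[simplified])

lemma fst_hom: "fst \<in> alg_hom A A1" and snd_hom: "snd \<in> alg_hom A A2"
  by (auto simp: alg_hom_def A_simps intro!: ring_hom_memI)

lemma fst_surj: "fst ` carrier A = carrier A1"
proof
  show "carrier A1 \<subseteq> fst ` carrier A"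
  proof
    fix x assume x: "x \<in> carrier A1"
    then obtain y where "y \<in> carrier A2" "p2 y = p1 x"
      using alg_homD(1)[OF p1 x] p2_surj by (metis imageE)
    then show "x \<in> fst ` carrier A"
      using x by (intro image_eqI[of _ _ "(x, y)"]) (auto simp: A_simps)
  qed
qed (auto simp: A_simps)

lemma snd_surj: "snd ` carrier A = carrier A2"
proof
  show "carrier A2 \<subseteq> snd ` carrier A"
  proof
    fix y assume y: "y \<in> carrier A2"
    then obtain x where "x \<in> carrier A1" "p1 x = p2 y"
      using alg_homD(1)[OF p2 y] p1_surj by (metis imageE)
    then show "y \<in> snd ` carrier A"
      using y by (intro image_eqI[of _ _ "(x, y)"]) (auto simp: A_simps)
  qed
qed (auto simp: A_simps)

lemma component_pair_unique:
  assumes "is_component_pair A1 A2 A \<Delta> D" "is_component_pair A1 A2 A \<Delta> E"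
  shows "D = E"
proof -
  obtain D1 D2 E1 E2 where [simp]: "D = (D1, D2)" "E = (E1, E2)" by (metis surj_pair)
  have eq: "D1 (fst a) = E1 (fst a)" "D2 (snd a) = E2 (snd a)" if "a \<in> carrier A" for a
    using assms that by (auto simp: is_component_pair_def)
  have "D1 = E1"
    by (rule extensionalityI[OF linear_mapsD(4) linear_mapsD(4)])
      (use assms eq(1) in \<open>auto simp: is_component_pair_def simp flip: fst_surj\<close>)
  moreover have "D2 = E2"
    by (rule extensionalityI[OF linear_mapsD(4) linear_mapsD(4)])
      (use assms eq(2) in \<open>auto simp: is_component_pair_def simp flip: snd_surj\<close>)
  ultimately show ?thesis by simp
qed

lemma Diff_components:
  assumes \<Delta>: "\<Delta> \<in> Diff k A" and D: "is_component_pair A1 A2 A \<Delta> (\<Delta>1, \<Delta>2)"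
  shows "\<Delta>1 \<in> Diff k A1" "\<Delta>2 \<in> Diff k A2"
    and "\<forall>a\<in>carrier A. p1 (\<Delta>1 (fst a)) = p2 (\<Delta>2 (snd a))"
proof -
  show "\<Delta>1 \<in> Diff k A1"
    by (rule Diff_descends[OF A_algebra A1 fst_hom fst_surj \<Delta>])
      (use D in \<open>auto simp: is_component_pair_def\<close>)
  show "\<Delta>2 \<in> Diff k A2"
    by (rule Diff_descends[OF A_algebra A2 snd_hom snd_surj \<Delta>])
      (use D in \<open>auto simp: is_component_pair_def\<close>)
  have "p1 (fst (\<Delta> a)) = p2 (snd (\<Delta> a))" if "a \<in> carrier A" for a
    using linear_mapsD(1)[OF DiffD(1)[OF \<Delta>] that] by (simp add: A_simps)
  then show "\<forall>a\<in>carrier A. p1 (\<Delta>1 (fst a)) = p2 (\<Delta>2 (snd a))"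
    using D by (auto simp: is_component_pair_def)
qed

lemma Diff_from_components:
  assumes \<Delta>1: "\<Delta>1 \<in> Diff k A1" and \<Delta>2: "\<Delta>2 \<in> Diff k A2"
    and compatible: "\<forall>a\<in>carrier A. p1 (\<Delta>1 (fst a)) = p2 (\<Delta>2 (snd a))"
  obtains \<Delta> where "\<Delta> \<in> Diff k A" "is_component_pair A1 A2 A \<Delta> (\<Delta>1, \<Delta>2)"
proof
  define \<Delta> where "\<Delta> = (\<lambda>a\<in>carrier A. (\<Delta>1 (fst a), \<Delta>2 (snd a)))"
  interpret A: Module.algebra real_alg A by (rule A_algebra)
  note lin = DiffD(1)[OF \<Delta>1] DiffD(1)[OF \<Delta>2]
  have closed: "\<Delta> a \<in> carrier A" if "a \<in> carrier A" for a
    using that compatible linear_mapsD(1)[OF lin(1)] linear_mapsD(1)[OF lin(2)]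
    unfolding \<Delta>_def by (simp add: A_simps)
  have comp: "fst (\<Delta> a) = \<Delta>1 (fst a)" "snd (\<Delta> a) = \<Delta>2 (snd a)" if "a \<in> carrier A" for a
    using that by (simp_all add: \<Delta>_def)
  have add: "\<Delta> (x \<oplus>\<^bsub>A\<^esub> y) = \<Delta> x \<oplus>\<^bsub>A\<^esub> \<Delta> y" if xy: "x \<in> carrier A" "y \<in> carrier A" for x y
    using xy A.M.a_closed[OF xy]
    by (simp add: \<Delta>_def A_simps(3) linear_mapsD(2)[OF lin(1)] linear_mapsD(2)[OF lin(2)])
      (simp add: A_simps(1) linear_mapsD(2)[OF lin(1)] linear_mapsD(2)[OF lin(2)])
  have smult: "\<Delta> (r \<odot>\<^bsub>A\<^esub> x) = r \<odot>\<^bsub>A\<^esub> \<Delta> x" if x: "x \<in> carrier A" for r x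
  proof -
    have "r \<odot>\<^bsub>A\<^esub> x \<in> carrier A" using A.smult_closed[of r x] x by simp
    then show ?thesis using x
      by (simp add: \<Delta>_def A_simps(6))
        (simp add: A_simps(1) linear_mapsD(3)[OF lin(1)] linear_mapsD(3)[OF lin(2)])
  qed
  have \<Delta>: "\<Delta> \<in> linear_maps A A"
    unfolding linear_maps_def using closed add smult by (auto simp: \<Delta>_def)
  show "is_component_pair A1 A2 A \<Delta> (\<Delta>1, \<Delta>2)"
    using lin comp by (simp add: is_component_pair_def)
  show "\<Delta> \<in> Diff k A"
  proof (rule DiffI[OF A_algebra \<Delta>])
    fix bs x assume bs: "length bs = k + 1" "set bs \<subseteq> carrier A" and x: "x \<in> carrier A"
    let ?y = "foldr (delta A) bs \<Delta> x"
    have bs': "fst ` set bs \<subseteq> carrier A1" "snd ` set bs \<subseteq> carrier A2"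
      using bs(2) A_simps(1) by blast+
    have "fst ?y = \<zero>\<^bsub>A1\<^esub>"
      using foldr_delta_intertwines[OF A_algebra A1 fst_hom \<Delta> comp(1) bs(2) x]
        DiffD(2)[OF \<Delta>1, of "map fst bs" "fst x"] bs bs' x by (auto simp: A_simps)
    moreover have "snd ?y = \<zero>\<^bsub>A2\<^esub>"
      using foldr_delta_intertwines[OF A_algebra A2 snd_hom \<Delta> comp(2) bs(2) x]
        DiffD(2)[OF \<Delta>2, of "map snd bs" "snd x"] bs bs' x by (auto simp: A_simps)
    ultimately show "?y = \<zero>\<^bsub>A\<^esub>" by (simp add: A_simps prod_eq_iff)
  qed
qed

lemma component_pair_determines:
  assumes "\<Delta> \<in> Diff k A" "\<Delta>' \<in> Diff k A"
    and "is_component_pair A1 A2 A \<Delta> D" "is_component_pair A1 A2 A \<Delta>' D"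
  shows "\<Delta> = \<Delta>'"
  by (rule extensionalityI[OF linear_mapsD(4) linear_mapsD(4), OF DiffD(1) DiffD(1)])
    (use assms in \<open>auto simp: is_component_pair_def prod_eq_iff\<close>)

lemma component_pair_exists:
  assumes geometric: "geometric A1" "geometric A2"
    and closure1: "(zariski A) closure_of ((zariski A) interior_of (Spec_map A fst ` Spec A1))
                     = Spec_map A fst ` Spec A1"
    and closure2: "(zariski A) closure_of ((zariski A) interior_of (Spec_map A snd ` Spec A2))
                     = Spec_map A snd ` Spec A2"
    and \<Delta>: "\<Delta> \<in> Diff k A"
  obtains \<Delta>1 \<Delta>2 where "is_component_pair A1 A2 A \<Delta> (\<Delta>1, \<Delta>2)"
proof -
  have inj: "a = \<zero>\<^bsub>A\<^esub>" if "fst a = \<zero>\<^bsub>A1\<^esub>" "snd a = \<zero>\<^bsub>A2\<^esub>" for a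
    using that by (simp add: A_simps prod_eq_iff)
  have ker1: "fst (\<Delta> a) = \<zero>\<^bsub>A1\<^esub>" if "a \<in> carrier A" "fst a = \<zero>\<^bsub>A1\<^esub>" for a
    by (rule Diff_preserves_kernel[OF A_algebra A1 A2 fst_hom snd_hom _ geometric closure1 \<Delta> that])
      (rule inj)
  have ker2: "snd (\<Delta> a) = \<zero>\<^bsub>A2\<^esub>" if "a \<in> carrier A" "snd a = \<zero>\<^bsub>A2\<^esub>" for a
    by (rule Diff_preserves_kernel[OF A_algebra A2 A1 snd_hom fst_hom _ geometric(2,1) closure2 \<Delta> that])
      (rule inj)
  obtain \<Delta>1 where "\<Delta>1 \<in> linear_maps A1 A1" "\<And>a. a \<in> carrier A \<Longrightarrow> fst (\<Delta> a) = \<Delta>1 (fst a)"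
    using linear_map_descends[OF A_algebra A1 fst_hom fst_surj DiffD(1)[OF \<Delta>] ker1] by blast
  moreover obtain \<Delta>2 where "\<Delta>2 \<in> linear_maps A2 A2" "\<And>a. a \<in> carrier A \<Longrightarrow> snd (\<Delta> a) = \<Delta>2 (snd a)"
    using linear_map_descends[OF A_algebra A2 snd_hom snd_surj DiffD(1)[OF \<Delta>] ker2] by blast
  ultimately have "is_component_pair A1 A2 A \<Delta> (\<Delta>1, \<Delta>2)"
    by (simp add: is_component_pair_def)
  then show thesis by (rule that)
qed

lemma Diff_bij_component_pairs:
  assumes geometric: "geometric A1" "geometric A2"
    and closure1: "(zariski A) closure_of ((zariski A) interior_of (Spec_map A fst ` Spec A1))
                     = Spec_map A fst ` Spec A1"
    and closure2: "(zariski A) closure_of ((zariski A) interior_of (Spec_map A snd ` Spec A2))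
                     = Spec_map A snd ` Spec A2"
  shows "(\<forall>\<Delta>\<in>Diff k A. \<exists>!D. is_component_pair A1 A2 A \<Delta> D) \<and>
         bij_betw (\<lambda>\<Delta>. THE D. is_component_pair A1 A2 A \<Delta> D) (Diff k A)
           {(\<Delta>1, \<Delta>2). \<Delta>1 \<in> Diff k A1 \<and> \<Delta>2 \<in> Diff k A2 \<and>
                       (\<forall>a\<in>carrier A. p1 (\<Delta>1 (fst a)) = p2 (\<Delta>2 (snd a)))}"
    (is "?unique \<and> bij_betw ?F _ ?R")
proof
  show unique: ?unique
    using component_pair_exists[OF assms] component_pair_unique by metis
  have F_eqI: "?F \<Delta> = D" if "is_component_pair A1 A2 A \<Delta> D" for \<Delta> D
    using that by (rule the_equality) (rule component_pair_unique[OF _ that])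
  have F: "is_component_pair A1 A2 A \<Delta> (?F \<Delta>)" if "\<Delta> \<in> Diff k A" for \<Delta>
    by (rule theI'[OF bspec[OF unique that]])
  show "bij_betw ?F (Diff k A) ?R"
    unfolding bij_betw_def
  proof (intro conjI equalityI subsetI)
    show "inj_on ?F (Diff k A)"
    proof (rule inj_onI)
      fix \<Delta> \<Delta>' assume in_Diff: "\<Delta> \<in> Diff k A" "\<Delta>' \<in> Diff k A" and "?F \<Delta> = ?F \<Delta>'"
      then show "\<Delta> = \<Delta>'"
        using component_pair_determines[OF in_Diff F[OF in_Diff(1)]] F[OF in_Diff(2)] by simp
    qed
    show "D \<in> ?R" if D: "D \<in> ?F ` Diff k A" for D
    proof -
      obtain \<Delta> where \<Delta>: "\<Delta> \<in> Diff k A" "D = ?F \<Delta>" using D by blast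
      obtain \<Delta>1 \<Delta>2 where pair: "D = (\<Delta>1, \<Delta>2)" by (cases D)
      have "is_component_pair A1 A2 A \<Delta> (\<Delta>1, \<Delta>2)"
        using F[OF \<Delta>(1)] unfolding \<Delta>(2)[symmetric] pair .
      then show ?thesis
        using Diff_components[OF \<Delta>(1)] pair by simp
    qed
    show "D \<in> ?F ` Diff k A" if D: "D \<in> ?R" for D
    proof -
      obtain \<Delta>1 \<Delta>2 where pair: "D = (\<Delta>1, \<Delta>2)" by (cases D)
      then have "\<Delta>1 \<in> Diff k A1" "\<Delta>2 \<in> Diff k A2"
        "\<forall>a\<in>carrier A. p1 (\<Delta>1 (fst a)) = p2 (\<Delta>2 (snd a))"
        using D by auto
      then obtain \<Delta> where "\<Delta> \<in> Diff k A" "is_component_pair A1 A2 A \<Delta> (\<Delta>1, \<Delta>2)"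
        by (rule Diff_from_components)
      then show ?thesis using F_eqI pair by (intro image_eqI[of _ _ \<Delta>]) simp_all
    qed
  qed
qed

end


section \<open>Smooth functions on a manifold\<close>

text \<open>A coordinate line with index \<open>i < n\<close> does not leave the space of sequences that vanish from \<open>n\<close> on.
  Hence it stays in a relatively open subset for a while, which makes partial derivatives depend
  only on the values of a function on that subset.\<close>

lemma eventually_coordinate_line_in_open:
  assumes S: "openin (Euclidean_space n) S" and x: "x \<in> S" and i: "i < n"
  shows "\<forall>\<^sub>F t in nhds (x i). x(i := t) \<in> S"
proof -
  obtain T where T: "open T" "S = T \<inter> {x. \<forall>i\<ge>n. x i = 0}"
    using S by (auto simp: Euclidean_space_def openin_subtopology euclidean_product_topology)
  have "continuous_on UNIV (\<lambda>t. x(i := t))"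
  proof (rule continuous_on_coordinatewise_then_product)
    show "continuous_on UNIV (\<lambda>t. (x(i := t)) j)" for j
      by (cases "j = i") simp_all
  qed
  then have "open ((\<lambda>t. x(i := t)) -` T)" using T(1) by (rule open_vimage[rotated])
  moreover have "x i \<in> (\<lambda>t. x(i := t)) -` T" using x T by simp
  ultimately have "\<forall>\<^sub>F t in nhds (x i). t \<in> (\<lambda>t. x(i := t)) -` T" by (rule eventually_nhds_in_open)
  then show ?thesis
    by (rule eventually_mono) (use x T i in auto)
qed

lemma Ck_on_cong:
  assumes S: "openin (Euclidean_space n) S"
    and "\<And>x. x \<in> S \<Longrightarrow> f x = g x" and "Ck_on k n S f"
  shows "Ck_on k n S g"
  using assms(2,3)
proof (induction k arbitrary: f g)
  case 0
  then show ?case by (auto elim!: continuous_map_eq)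
next
  case (Suc k)
  have ev: "\<forall>\<^sub>F t in nhds (x i). f (x(i := t)) = g (x(i := t))" if "x \<in> S" "i < n" for x i
    using eventually_coordinate_line_in_open[OF S that] by (rule eventually_mono) (rule Suc.prems)
  have "(\<lambda>t. g (x(i := t))) field_differentiable at (x i)" if xi: "x \<in> S" "i < n" for x i
  proof -
    obtain D where "((\<lambda>t. f (x(i := t))) has_field_derivative D) (at (x i))"
      using Suc.prems(2) xi unfolding Ck_on.simps field_differentiable_def by blast
    then have "((\<lambda>t. g (x(i := t))) has_field_derivative D) (at (x i))"
      using DERIV_cong_ev[OF refl ev[OF xi] refl] by blast
    then show ?thesis unfolding field_differentiable_def by blast
  qed
  moreover have "Ck_on k n S (partial_deriv i g)" if "i < n" for i
  proof (rule Suc.IH)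
    show "partial_deriv i f x = partial_deriv i g x" if "x \<in> S" for x
      unfolding partial_deriv_def by (rule deriv_cong_ev[OF ev[OF that \<open>i < n\<close>] refl])
  qed (use Suc.prems(2) that in simp)
  moreover have "continuous_map (subtopology (Euclidean_space n) S) euclideanreal g"
    using Suc.prems by (auto elim!: continuous_map_eq)
  ultimately show ?case by simp
qed

lemma Ck_on_Suc_imp: "Ck_on (Suc k) n S f \<Longrightarrow> Ck_on k n S f"
proof (induction k arbitrary: f)
  case (Suc k)
  note f = Suc.prems[unfolded Ck_on.simps(2)[of "Suc k"]]
  have "Ck_on k n S (partial_deriv i f)" if "i < n" for i
    by (rule Suc.IH) (use f that in blast)
  then show ?case using f by (subst Ck_on.simps(2)) blast
qed simp

lemma Ck_on_const: "Ck_on k n S (\<lambda>x. c)"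
proof (induction k arbitrary: c)
  case (Suc k)
  have "partial_deriv i (\<lambda>x. c) = (\<lambda>x. 0)" for i by (simp add: partial_deriv_def fun_eq_iff)
  then show ?case using Suc.IH[of 0] by simp
qed simp

lemma Ck_on_add:
  assumes S: "openin (Euclidean_space n) S" and "Ck_on k n S f" "Ck_on k n S g"
  shows "Ck_on k n S (\<lambda>x. f x + g x)"
  using assms(2,3)
proof (induction k arbitrary: f g)
  case 0
  then show ?case by (auto intro!: continuous_intros)
next
  case (Suc k)
  have "Ck_on k n S (partial_deriv i (\<lambda>x. f x + g x))" if i: "i < n" for i
  proof (rule Ck_on_cong[OF S])
    show "Ck_on k n S (\<lambda>x. partial_deriv i f x + partial_deriv i g x)"
      by (rule Suc.IH) (use Suc.prems i in auto)
    show "partial_deriv i f x + partial_deriv i g x = partial_deriv i (\<lambda>x. f x + g x) x"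
      if "x \<in> S" for x
      unfolding partial_deriv_def using Suc.prems that i by (subst deriv_add) auto
  qed
  moreover have "(\<lambda>t. f (x(i := t)) + g (x(i := t))) field_differentiable at (x i)"
    if "x \<in> S" "i < n" for x i
    by (rule field_differentiable_add) (use Suc.prems that in auto)
  ultimately show ?case
    using Suc.prems by (auto intro!: continuous_intros)
qed

text \<open>Besides partial derivatives, the Leibniz rule involves the factors themselves. For these
  the induction hypothesis applies because \<open>C\<^sup>k\<^sup>+\<^sup>1\<close> functions are \<open>C\<^sup>k\<close>.\<close>

lemma Ck_on_mult:
  assumes S: "openin (Euclidean_space n) S" and "Ck_on k n S f" "Ck_on k n S g"
  shows "Ck_on k n S (\<lambda>x. f x * g x)"
  using assms(2,3)
proof (induction k arbitrary: f g)
  case 0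
  then show ?case by (auto intro!: continuous_intros)
next
  case (Suc k)
  have "Ck_on k n S (partial_deriv i (\<lambda>x. f x * g x))" if i: "i < n" for i
  proof (rule Ck_on_cong[OF S])
    show "Ck_on k n S (\<lambda>x. f x * partial_deriv i g x + partial_deriv i f x * g x)"
      by (intro Ck_on_add[OF S] Suc.IH Suc.prems[THEN Ck_on_Suc_imp]) (use Suc.prems i in auto)
    show "f x * partial_deriv i g x + partial_deriv i f x * g x = partial_deriv i (\<lambda>x. f x * g x) x"
      if "x \<in> S" for x
      unfolding partial_deriv_def using Suc.prems that i by (subst deriv_mult) auto
  qed
  moreover have "(\<lambda>t. f (x(i := t)) * g (x(i := t))) field_differentiable at (x i)"
    if "x \<in> S" "i < n" for x i
    by (rule field_differentiable_mult) (use Suc.prems that in auto)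
  ultimately show ?case
    using Suc.prems by (auto intro!: continuous_intros)
qed

lemma smooth_manifold_chartD:
  assumes "smooth_manifold n M \<A>" "(U, \<phi>) \<in> \<A>"
  shows "openin (Euclidean_space n) (\<phi> ` U)" "U \<subseteq> topspace M"
  using assms openin_subset
  by (fastforce simp: smooth_manifold_def smooth_atlas_def is_chart_def)+

lemma smooth_functionsI:
  assumes M: "smooth_manifold n M \<A>"
    and smooth: "\<And>U \<phi>. (U, \<phi>) \<in> \<A> \<Longrightarrow> smooth_on n (\<phi> ` U) (\<lambda>x. f (inv_into U \<phi> x))"
  shows "restrict f (topspace M) \<in> carrier (smooth_functions n M \<A>)"
proof -
  have "smooth_on n (\<phi> ` U) (\<lambda>x. restrict f (topspace M) (inv_into U \<phi> x))" if "(U, \<phi>) \<in> \<A>" for U \<phi>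
    unfolding smooth_on_def
  proof
    fix k
    show "Ck_on k n (\<phi> ` U) (\<lambda>x. restrict f (topspace M) (inv_into U \<phi> x))"
    proof (rule Ck_on_cong[OF smooth_manifold_chartD(1)[OF M that]])
      show "Ck_on k n (\<phi> ` U) (\<lambda>x. f (inv_into U \<phi> x))"
        using smooth[OF that] by (simp add: smooth_on_def)
      show "f (inv_into U \<phi> x) = restrict f (topspace M) (inv_into U \<phi> x)" if "x \<in> \<phi> ` U" for x
        using inv_into_into[OF that] smooth_manifold_chartD(2)[OF M \<open>(U, \<phi>) \<in> \<A>\<close>] by auto
    qed
  qed
  then show ?thesis by (auto simp: smooth_functions_def)
qed

lemma smooth_functions_simps:
  "x \<otimes>\<^bsub>smooth_functions n M \<A>\<^esub> y = (\<lambda>m\<in>topspace M. x m * y m)"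
  "x \<oplus>\<^bsub>smooth_functions n M \<A>\<^esub> y = (\<lambda>m\<in>topspace M. x m + y m)"
  "r \<odot>\<^bsub>smooth_functions n M \<A>\<^esub> x = (\<lambda>m\<in>topspace M. r * x m)"
  "\<one>\<^bsub>smooth_functions n M \<A>\<^esub> = (\<lambda>m\<in>topspace M. 1)"
  "\<zero>\<^bsub>smooth_functions n M \<A>\<^esub> = (\<lambda>m\<in>topspace M. 0)"
  by (simp_all add: smooth_functions_def)

lemma smooth_functions_closed:
  assumes M: "smooth_manifold n M \<A>"
  shows "(\<lambda>m\<in>topspace M. c) \<in> carrier (smooth_functions n M \<A>)"
    and "f \<in> carrier (smooth_functions n M \<A>) \<Longrightarrow> g \<in> carrier (smooth_functions n M \<A>) \<Longrightarrow>
           (\<lambda>m\<in>topspace M. f m + g m) \<in> carrier (smooth_functions n M \<A>)"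
    and "f \<in> carrier (smooth_functions n M \<A>) \<Longrightarrow> g \<in> carrier (smooth_functions n M \<A>) \<Longrightarrow>
           (\<lambda>m\<in>topspace M. f m * g m) \<in> carrier (smooth_functions n M \<A>)"
    and "f \<in> carrier (smooth_functions n M \<A>) \<Longrightarrow>
           (\<lambda>m\<in>topspace M. r * f m) \<in> carrier (smooth_functions n M \<A>)"
proof -
  have chart: "Ck_on k n (\<phi> ` U) (\<lambda>x. f (inv_into U \<phi> x))"
    if "f \<in> carrier (smooth_functions n M \<A>)" "(U, \<phi>) \<in> \<A>" for f U \<phi> k
    using that by (auto simp: smooth_functions_def smooth_on_def)
  note op = smooth_manifold_chartD(1)[OF M]
  show "(\<lambda>m\<in>topspace M. c) \<in> carrier (smooth_functions n M \<A>)"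
    by (rule smooth_functionsI[OF M]) (simp add: smooth_on_def Ck_on_const)
  show "(\<lambda>m\<in>topspace M. f m + g m) \<in> carrier (smooth_functions n M \<A>)"
    if "f \<in> carrier (smooth_functions n M \<A>)" "g \<in> carrier (smooth_functions n M \<A>)"
    by (rule smooth_functionsI[OF M]) (use that in \<open>simp add: smooth_on_def Ck_on_add op chart\<close>)
  show "(\<lambda>m\<in>topspace M. f m * g m) \<in> carrier (smooth_functions n M \<A>)"
    if "f \<in> carrier (smooth_functions n M \<A>)" "g \<in> carrier (smooth_functions n M \<A>)"
    by (rule smooth_functionsI[OF M]) (use that in \<open>simp add: smooth_on_def Ck_on_mult op chart\<close>)
  show "(\<lambda>m\<in>topspace M. r * f m) \<in> carrier (smooth_functions n M \<A>)"
    if "f \<in> carrier (smooth_functions n M \<A>)"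
    by (rule smooth_functionsI[OF M])
      (use that in \<open>simp add: smooth_on_def Ck_on_mult Ck_on_const op chart\<close>)
qed

lemma smooth_functions_extensional:
  "f \<in> carrier (smooth_functions n M \<A>) \<Longrightarrow> f \<in> extensional (topspace M)"
  by (simp add: smooth_functions_def)

lemma smooth_functions_algebra:
  assumes M: "smooth_manifold n M \<A>"
  shows "Module.algebra real_alg (smooth_functions n M \<A>)"
proof (intro algebraI real_alg_cring)
  note closed = smooth_functions_closed[OF M] and ops = smooth_functions_simps
  have restrict_id: "(\<lambda>m\<in>topspace M. f m) = f" if "f \<in> carrier (smooth_functions n M \<A>)" for f
    using smooth_functions_extensional[OF that] by (rule extensional_restrict)
  show "cring (smooth_functions n M \<A>)"
  proof (intro cringI abelian_groupI comm_monoidI)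
    show "\<exists>y\<in>carrier (smooth_functions n M \<A>).
            y \<oplus>\<^bsub>smooth_functions n M \<A>\<^esub> x = \<zero>\<^bsub>smooth_functions n M \<A>\<^esub>"
      if "x \<in> carrier (smooth_functions n M \<A>)" for x
      by (rule bexI[OF _ closed(4)[OF that, of "- 1"]]) (auto simp: ops)
  qed (auto simp: ops closed restrict_id algebra_simps cong: restrict_cong)
qed (auto simp: smooth_functions_simps smooth_functions_closed[OF M] algebra_simps
      smooth_functions_extensional extensional_restrict cong: restrict_cong)

text \<open>Evaluations at the points of \<open>M\<close> belong to the spectrum and already determine a function.\<close>

lemma smooth_functions_geometric:
  assumes M: "smooth_manifold n M \<A>"
  shows "geometric (smooth_functions n M \<A>)"
  unfolding geometric_def
proof (intro ballI impI)
  let ?A = "smooth_functions n M \<A>"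
  fix f assume f: "f \<in> carrier ?A" and zero: "\<forall>h\<in>Spec ?A. h f = 0"
  have "f m = 0" if m: "m \<in> topspace M" for m
  proof -
    let ?ev = "\<lambda>g\<in>carrier ?A. g m"
    have "?ev \<in> Spec ?A"
      unfolding Spec_def alg_hom_def
      using m smooth_functions_closed[OF M]
      by (auto simp: smooth_functions_simps intro!: ring_hom_memI)
    then show ?thesis using zero f by force
  qed
  then show "f = \<zero>\<^bsub>?A\<^esub>"
    using smooth_functions_extensional[OF f]
    by (auto simp: smooth_functions_simps extensional_def fun_eq_iff)
qed


section \<open>Differential operators on the fibre product of two manifolds\<close>

theorem theorem2p4:
  fixes M1 :: "'m1 topology" and M2 :: "'m2 topology"
    and \<A>1 :: "'m1 chart set" and \<A>2 :: "'m2 chart set"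
    and n1 n2 k :: nat
    and C :: "(real, 'c) module"
    and p1 :: "('m1 \<Rightarrow> real) \<Rightarrow> 'c" and p2 :: "('m2 \<Rightarrow> real) \<Rightarrow> 'c"
    and A1 :: "(real, 'm1 \<Rightarrow> real) module" and A2 :: "(real, 'm2 \<Rightarrow> real) module"
    and A :: "(real, ('m1 \<Rightarrow> real) \<times> ('m2 \<Rightarrow> real)) module"
  assumes M1: "smooth_manifold n1 M1 \<A>1" and M2: "smooth_manifold n2 M2 \<A>2"
    and A1_eq: "A1 = smooth_functions n1 M1 \<A>1"
    and A2_eq: "A2 = smooth_functions n2 M2 \<A>2"
    and C: "Module.algebra real_alg C"
    and p1: "p1 \<in> alg_hom A1 C" "p1 ` carrier A1 = carrier C"
    and p2: "p2 \<in> alg_hom A2 C" "p2 ` carrier A2 = carrier C"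
    and A_eq: "A = fibre_product A1 A2 p1 p2"
    and closure1: "(zariski A) closure_of ((zariski A) interior_of (Spec_map A fst ` Spec A1))
                     = Spec_map A fst ` Spec A1"
    and closure2: "(zariski A) closure_of ((zariski A) interior_of (Spec_map A snd ` Spec A2))
                     = Spec_map A snd ` Spec A2"
  shows "(\<forall>\<Delta>\<in>Diff k A. \<exists>!D. is_component_pair A1 A2 A \<Delta> D) \<and>
         bij_betw (\<lambda>\<Delta>. THE D. is_component_pair A1 A2 A \<Delta> D) (Diff k A)
           {(\<Delta>1, \<Delta>2). \<Delta>1 \<in> Diff k A1 \<and> \<Delta>2 \<in> Diff k A2 \<and>
                       (\<forall>a\<in>carrier A. p1 (\<Delta>1 (fst a)) = p2 (\<Delta>2 (snd a)))}"
proof -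
  have pr1: "Module.algebra real_alg A1" "geometric A1"
    unfolding A1_eq using smooth_functions_algebra[OF M1] smooth_functions_geometric[OF M1] by auto
  have pr2: "Module.algebra real_alg A2" "geometric A2"
    unfolding A2_eq using smooth_functions_algebra[OF M2] smooth_functions_geometric[OF M2] by auto
  have "fibre_square A1 A2 C p1 p2 A"
    by (rule fibre_square.intro[OF pr1(1) pr2(1) C p1 p2 A_eq])
  then show ?thesis
    by (rule fibre_square.Diff_bij_component_pairs[OF _ pr1(2) pr2(2) closure1 closure2])
qed

end
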